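(* Let $x\sim p_X$ be an $X$-valued random variable, let $y^\delta = Ax+\eta$ with $\eta\sim\mathcal N(0,\delta^2 I)$ independent of $x$, and let $z^\delta = A^\ast y^\delta$. Then $p(x\mid y^\delta)=p(x\mid z^\delta)$ for $z^\delta=A^\ast y^\delta$, i.e. the posterior density of $x$ given $y^\delta$ coincides with the posterior density of $x$ given $z^\delta=A^\ast y^\delta$. Consequently the posterior mean for the original problem (recover $x$ from $y^\delta=Ax+\eta$) and the posterior mean for the normal-equation problem (recover $x$ from $z^\delta=A^\ast A x+A^\ast\eta$) are equal. Furthermore, the posterior mean $x_{\mathrm{PM}}=\mathbb E_{p(x\mid y^\delta)}(x)$ satisfies, for every $y^\delta\in Y$, $$A\,x_{\mathrm{PM}} = y^\delta+\delta^2\,\nabla_y(\log p_Y)(y^\delta).$$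
   Context: $X=\mathbb R^{n_X}$ and $Y=\mathbb R^{n_Y}$ with Euclidean inner products; $A:X\to Y$ is a linear map (not assumed injective or surjective) with adjoint $A^\ast$; $\delta>0$. The prior $p_X:X\to\mathbb R_{>0}$ is a continuously differentiable, everywhere positive probability density which decays sufficiently fast that all expectations involved (here, the posterior means) exist. The noise density is $p_H(\eta)=(\delta\sqrt{2\pi})^{-n_Y}\exp(-\|\eta\|^2/(2\delta^2))$ on $Y$. The density of the data is $p_Y(y)=\int_X p_X(x)\,p_H(Ax-y)\,\mathrm dx$. The posterior density given $y$ is $$p(x\mid y)=\frac{1}{p_Y(y)}\,p_H(Ax-y)\,p_X(x).$$ $p(\cdot\mid z)$, for $z\in\operatorname{im}(A^\ast)$, denotes the conditional density of $x$ given $A^\ast y^\delta=z$ (a version of the regular conditional density of $x$ given the random variable $z^\delta=A^\ast y^\delta$); thus $p(x\mid y^\delta)=p(x\mid z^\delta)$ says that $p(x\mid y)$ depends on $y$ only through $A^\ast y$ and, as a function of $z=A^\ast y$, is such a version. *)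

theory Defs
  imports "HOL-Probability.Probability"
begin

definition continuously_differentiable :: "('a::real_inner \<Rightarrow> real) \<Rightarrow> bool" where
  "continuously_differentiable f \<longleftrightarrow>
     (\<exists>g. (\<forall>x. GDERIV f x :> g x) \<and> continuous_on UNIV g)"

definition noise_density :: "real \<Rightarrow> real ^ 'm \<Rightarrow> real" where
  "noise_density \<delta> \<eta> =
     1 / (\<delta> * sqrt (2 * pi)) ^ CARD('m) * exp (- (norm \<eta>)\<^sup>2 / (2 * \<delta>\<^sup>2))"

definition data_density ::
  "(real ^ 'n \<Rightarrow> real) \<Rightarrow> (real ^ 'n \<Rightarrow> real ^ 'm) \<Rightarrow> real \<Rightarrow> real ^ 'm \<Rightarrow> real" where
  "data_density pX A \<delta> y = (\<integral>x. pX x * noise_density \<delta> (A x - y) \<partial>lborel)"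

definition posterior_density ::
  "(real ^ 'n \<Rightarrow> real) \<Rightarrow> (real ^ 'n \<Rightarrow> real ^ 'm) \<Rightarrow> real \<Rightarrow> real ^ 'm \<Rightarrow> real ^ 'n \<Rightarrow> real" where
  "posterior_density pX A \<delta> y x =
     1 / data_density pX A \<delta> y * noise_density \<delta> (A x - y) * pX x"

definition density_mean :: "('a::euclidean_space \<Rightarrow> real) \<Rightarrow> 'a" where
  "density_mean p = (\<integral>x. p x *\<^sub>R x \<partial>lborel)"

text \<open>
  \<open>cond_density M X Z S q\<close>: the map \<open>z \<mapsto> q z\<close>, for \<open>z\<close> in \<open>S\<close>, is a version of the regular
  conditional Lebesgue density of \<open>X\<close> given \<open>Z\<close>, where \<open>Z\<close> takes its values in \<open>S\<close>.
  The law of \<open>Z\<close> need not have a density (\<open>S\<close> may be a proper subspace),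
  so the disintegration identity is written with the law of \<open>Z\<close> itself.  Values of \<open>q\<close> outside
  \<open>S\<close> are irrelevant.
\<close>
definition cond_density ::
  "'s measure \<Rightarrow> ('s \<Rightarrow> 'a::euclidean_space) \<Rightarrow> ('s \<Rightarrow> 'b::euclidean_space) \<Rightarrow> 'b set
     \<Rightarrow> ('b \<Rightarrow> 'a \<Rightarrow> real) \<Rightarrow> bool" where
  "cond_density M X Z S q \<longleftrightarrow>
     X \<in> borel_measurable M \<and>
     Z \<in> measurable M (restrict_space borel S) \<and>
     (\<lambda>(z, x). q z x) \<in> borel_measurable (restrict_space borel S \<Otimes>\<^sub>M borel) \<and>
     (\<forall>z\<in>S. (\<forall>x. 0 \<le> q z x) \<and> (\<integral>\<^sup>+x. ennreal (q z x) \<partial>lborel) = 1) \<and>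
     (\<forall>B\<in>sets borel. \<forall>C\<in>sets (restrict_space borel S).
        emeasure M {\<omega> \<in> space M. X \<omega> \<in> B \<and> Z \<omega> \<in> C} =
        (\<integral>\<^sup>+z\<in>C. (\<integral>\<^sup>+x\<in>B. ennreal (q z x) \<partial>lborel) \<partial>distr M (restrict_space borel S) Z))"

end

theory Submission
  imports Defs
begin

text \<open>
  Expanding \<open>(norm (A u - y))\<^sup>2\<close> shows that the likelihood is a factor depending only on \<open>y\<close> times
  \<open>exp ((2 * (u \<bullet> adjoint A y) - (norm (A u))\<^sup>2) / (2 * \<delta>\<^sup>2))\<close>; the former cancels in the posterior,
  which is therefore a function of \<open>adjoint A y\<close>.  By Fubini and translation invariance \<open>(x, yd)\<close> has
  density \<open>data_density y * posterior_density y u\<close>, so integrating functions of \<open>adjoint A y\<close> against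
  it yields the disintegration identity for \<open>zd\<close>.  Versions of a conditional density agree almost
  everywhere because their densities with respect to the product of the law of \<open>zd\<close> and Lebesgue
  measure agree on rectangles.  For the last claim, the gradient of the noise density is bounded, so
  dominated convergence differentiates \<open>data_density\<close> under the integral sign, and the gradient of the
  integrand is \<open>(A u - y) / \<delta>\<^sup>2\<close> times the integrand.
\<close>

section \<open>Differentiation under the integral sign\<close>

text \<open>The first-order remainder of \<open>F\<close> at \<open>y\<close>, divided by
  \<open>norm (v - y)\<close>, tends to 0 pointwise. It is dominated by \<open>2 * w\<close>: one
  \<open>w\<close> from the Lipschitz bound based at \<open>y\<close>, the other from the bound on
  \<open>G\<close> and Cauchy-Schwarz.\<close>

lemma gderiv_integral:
  fixes F :: "'a::euclidean_space \<Rightarrow> 'b \<Rightarrow> real"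
  assumes F: "\<And>v. integrable M (F v)"
    and G[measurable]: "G \<in> borel_measurable M"
    and w: "integrable M w"
    and deriv: "\<And>u. GDERIV (\<lambda>v. F v u) y :> G u"
    and lipschitz: "\<And>v u. \<bar>F v u - F y u\<bar> \<le> w u * norm (v - y)"
    and bound: "\<And>u. norm (G u) \<le> w u"
  shows "integrable M G" "GDERIV (\<lambda>v. \<integral>u. F v u \<partial>M) y :> (\<integral>u. G u \<partial>M)"
proof -
  show G_int: "integrable M G"
    using bound by (intro Bochner_Integration.integrable_bound[OF w]) (auto intro: order_trans[OF _ abs_ge_self])
  have "((\<lambda>v. norm ((\<integral>u. F v u \<partial>M) - (\<integral>u. F y u \<partial>M) - (v - y) \<bullet> (\<integral>u. G u \<partial>M)) / norm (v - y))
    \<longlongrightarrow> 0) (at y)"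
    \<comment> \<open>Dominated convergence is applied along sequences that avoid
      \<open>y\<close>.\<close>
    unfolding tendsto_at_iff_sequentially
  proof (intro allI impI)
    fix X :: "nat \<Rightarrow> 'a"
    assume X: "\<forall>i. X i \<in> UNIV - {y}" and lim: "X \<longlonglongrightarrow> y"
    \<comment> \<open>The quotient is kept signed: being linear in \<open>F\<close> and
      \<open>G\<close>, its integral is the corresponding quotient of the integrals.\<close>
    define s where "s i u = (F (X i) u - F y u - (X i - y) \<bullet> G u) / norm (X i - y)" for i u
    have [measurable]: "F v \<in> borel_measurable M" for v
      using F by auto
    have "(\<lambda>i. \<integral>u. s i u \<partial>M) \<longlonglongrightarrow> (\<integral>u. 0 \<partial>M)"
    proof (rule integral_dominated_convergence[where w="\<lambda>u. 2 * w u"])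
      show "s i \<in> borel_measurable M" for i
        unfolding s_def by measurable
      show "AE u in M. (\<lambda>i. s i u) \<longlonglongrightarrow> 0"
      proof (rule AE_I2)
        fix u
        have "((\<lambda>v. norm (F v u - F y u - (v - y) \<bullet> G u) / norm (v - y)) \<longlongrightarrow> 0) (at y)"
          using deriv[of u] unfolding gderiv_def has_derivative_iff_norm by auto
        hence "(\<lambda>i. norm (s i u)) \<longlonglongrightarrow> 0"
          unfolding tendsto_at_iff_sequentially s_def using X lim by (auto simp: o_def)
        thus "(\<lambda>i. s i u) \<longlonglongrightarrow> 0"
          by (rule tendsto_norm_zero_cancel)
      qed
      show "AE u in M. norm (s i u) \<le> 2 * w u" for i
      proof (rule AE_I2)
        fix u
        have "norm (F (X i) u - F y u - (X i - y) \<bullet> G u)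
            \<le> norm (F (X i) u - F y u) + norm ((X i - y) \<bullet> G u)"
          by (rule norm_triangle_ineq4)
        also have "\<dots> \<le> w u * norm (X i - y) + norm (X i - y) * w u"
          unfolding real_norm_def
          by (intro add_mono lipschitz order_trans[OF Cauchy_Schwarz_ineq2] mult_left_mono bound norm_ge_zero)
        finally show "norm (s i u) \<le> 2 * w u"
          using X by (simp add: s_def divide_simps algebra_simps)
      qed
    qed (use w in auto)
    moreover have "(\<integral>u. s i u \<partial>M) =
        ((\<integral>u. F (X i) u \<partial>M) - (\<integral>u. F y u \<partial>M) - (X i - y) \<bullet> (\<integral>u. G u \<partial>M)) / norm (X i - y)" for i
      unfolding s_def using F G_int by simp
    ultimately show "((\<lambda>v. norm ((\<integral>u. F v u \<partial>M) - (\<integral>u. F y u \<partial>M) - (v - y) \<bullet> (\<integral>u. G u \<partial>M)) / norm (v - y))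
        \<circ> X) \<longlonglongrightarrow> 0"
      using tendsto_norm_zero[of "\<lambda>i. \<integral>u. s i u \<partial>M"] by (simp add: o_def)
  qed
  thus "GDERIV (\<lambda>v. \<integral>u. F v u \<partial>M) y :> (\<integral>u. G u \<partial>M)"
    unfolding gderiv_def has_derivative_iff_norm
    by (simp add: bounded_linear_inner_left)
qed

section \<open>Bounds and gradient of the Gaussian noise density\<close>

lemma noise_density_pos: "\<delta> > 0 \<Longrightarrow> noise_density \<delta> w > 0"
  by (simp add: noise_density_def)

lemma noise_density_le:
  fixes w :: "real ^ 'm"
  assumes "\<delta> > 0"
  shows "noise_density \<delta> w \<le> 1 / (\<delta> * sqrt (2 * pi)) ^ CARD('m)"
  using assms by (simp add: noise_density_def divide_simps)

lemma noise_density_minus_commute: "noise_density \<delta> (v - w) = noise_density \<delta> (w - v)"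
  by (simp add: noise_density_def norm_minus_commute)

lemma borel_measurable_noise_density[measurable]: "noise_density \<delta> \<in> borel_measurable borel"
  unfolding noise_density_def[abs_def] by measurable

lemma GDERIV_noise_density:
  fixes w :: "real ^ 'm"
  assumes "\<delta> \<noteq> 0"
  shows "GDERIV (noise_density \<delta>) w :> - (noise_density \<delta> w / \<delta>\<^sup>2) *\<^sub>R w"
  unfolding gderiv_def noise_density_def[abs_def] power2_norm_eq_inner
  using assms by (auto intro!: derivative_eq_intros simp: inner_commute field_simps fun_eq_iff)

text \<open>In the scaled variable \<open>s = norm w / \<delta>\<close> the bound reduces to
  \<open>s * exp (- (s\<^sup>2 / 2)) \<le> 1\<close>.\<close>

lemma norm_gradient_noise_density_le:
  fixes w :: "real ^ 'm"
  assumes "\<delta> > 0"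
  shows "norm (- (noise_density \<delta> w / \<delta>\<^sup>2) *\<^sub>R w) \<le> 1 / (\<delta> * sqrt (2 * pi)) ^ CARD('m) / \<delta>"
proof -
  define s where "s = norm w / \<delta>"
  \<comment> \<open>The square gives \<open>s \<le> 1/2 + s\<^sup>2 / 2\<close>, which is weakened
    to match \<open>1 + t \<le> exp t\<close> at \<open>t = s\<^sup>2 / 2\<close>.\<close>
  have "0 \<le> (s - 1)\<^sup>2" by simp
  hence "s \<le> 1 + s\<^sup>2 / 2" by (simp add: power2_eq_square algebra_simps)
  also have "\<dots> \<le> exp (s\<^sup>2 / 2)" by (rule exp_ge_add_one_self)
  finally have "s * exp (- (s\<^sup>2 / 2)) \<le> 1"
    by (simp add: exp_minus field_simps)
  hence "exp (- (norm w)\<^sup>2 / (2 * \<delta>\<^sup>2)) * norm w / \<delta>\<^sup>2 \<le> 1 / \<delta>"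
    using assms by (simp add: s_def power2_eq_square field_simps)
  hence "1 / (\<delta> * sqrt (2 * pi)) ^ CARD('m) * (exp (- (norm w)\<^sup>2 / (2 * \<delta>\<^sup>2)) * norm w / \<delta>\<^sup>2)
      \<le> 1 / (\<delta> * sqrt (2 * pi)) ^ CARD('m) * (1 / \<delta>)"
    using assms by (intro mult_left_mono) auto
  thus ?thesis
    using assms by (simp add: noise_density_def abs_mult)
qed

text \<open>Mean value inequality on the whole space: by Cauchy-Schwarz the operator norm of the
  derivative is at most the norm of the gradient, so the gradient bound is a global Lipschitz
  constant.\<close>

lemma noise_density_lipschitz:
  fixes v w :: "real ^ 'm"
  assumes "\<delta> > 0"
  shows "\<bar>noise_density \<delta> v - noise_density \<delta> w\<bar>
    \<le> 1 / (\<delta> * sqrt (2 * pi)) ^ CARD('m) / \<delta> * norm (v - w)"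
proof -
  have "norm (noise_density \<delta> v - noise_density \<delta> w)
    \<le> 1 / (\<delta> * sqrt (2 * pi)) ^ CARD('m) / \<delta> * norm (v - w)"
  proof (rule differentiable_bound[where S=UNIV])
    fix u :: "real ^ 'm"
    show "(noise_density \<delta> has_derivative (\<lambda>h. h \<bullet> (- (noise_density \<delta> u / \<delta>\<^sup>2) *\<^sub>R u))) (at u within UNIV)"
      using GDERIV_noise_density[of \<delta> u] assms by (simp add: gderiv_def)
    show "onorm (\<lambda>h. h \<bullet> (- (noise_density \<delta> u / \<delta>\<^sup>2) *\<^sub>R u))
        \<le> 1 / (\<delta> * sqrt (2 * pi)) ^ CARD('m) / \<delta>"
    proof (rule onorm_le)
      fix h :: "real ^ 'm"
      show "norm (h \<bullet> (- (noise_density \<delta> u / \<delta>\<^sup>2) *\<^sub>R u))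
          \<le> 1 / (\<delta> * sqrt (2 * pi)) ^ CARD('m) / \<delta> * norm h"
        unfolding real_norm_def mult.commute[of _ "norm h"]
        by (rule order_trans[OF Cauchy_Schwarz_ineq2])
          (intro mult_left_mono norm_gradient_noise_density_le assms norm_ge_zero)
    qed
  qed auto
  thus ?thesis by simp
qed


section \<open>Versions of a conditional density\<close>

lemma cond_density_unique:
  assumes "prob_space M"
    and q: "cond_density M X Z S q" and q': "cond_density M X Z S q'"
  shows "AE z in distr M (restrict_space borel S) Z. AE x in lborel. q z x = q' z x"
proof -
  interpret prob_space M by fact
  define R where "R = restrict_space borel S"
  define D where "D = distr M R Z"
  have [measurable]: "X \<in> borel_measurable M" "Z \<in> measurable M R"
    using q by (auto simp: cond_density_def R_def)
  have space_R: "space R = S"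
    by (simp add: R_def space_restrict_space)
  interpret D: prob_space D
    unfolding D_def by (rule prob_space_distr) simp
  interpret D: pair_sigma_finite D "lborel :: 'b measure" ..
  have [measurable_cong]: "sets D = sets R"
    by (simp add: D_def)
  have space_D: "space D = S"
    by (simp add: D_def space_R)
  have meas: "(\<lambda>p. ennreal (r (fst p) (snd p))) \<in> borel_measurable (D \<Otimes>\<^sub>M lborel)"
    if "cond_density M X Z S r" for r
  proof -
    have "(\<lambda>(z, x). r z x) \<in> borel_measurable (R \<Otimes>\<^sub>M borel)"
      using that by (simp add: cond_density_def R_def)
    hence "(\<lambda>(z, x). r z x) \<in> borel_measurable (D \<Otimes>\<^sub>M lborel)"
      by (simp cong: measurable_cong_sets sets_pair_measure_cong add: D_def)
    thus ?thesis
      by (simp add: case_prod_unfold)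
  qed
  \<comment> \<open>By Tonelli, the disintegration identity says that a version \<open>r\<close>,
    taken as a density on the product, has the joint law of \<open>(Z, X)\<close> on rectangles. The
    right-hand side does not mention \<open>r\<close>.\<close>
  have rect: "emeasure (density (D \<Otimes>\<^sub>M lborel) (\<lambda>p. ennreal (r (fst p) (snd p)))) (C \<times> B) =
      emeasure M {\<omega> \<in> space M. X \<omega> \<in> B \<and> Z \<omega> \<in> C}"
    if r: "cond_density M X Z S r" and [measurable]: "C \<in> sets R" "B \<in> sets borel" for r B C
  proof -
    have [measurable]: "(\<lambda>p. ennreal (r (fst p) (snd p))) \<in> borel_measurable (D \<Otimes>\<^sub>M lborel)"
      by (rule meas[OF r])
    have "emeasure (density (D \<Otimes>\<^sub>M lborel) (\<lambda>p. ennreal (r (fst p) (snd p)))) (C \<times> B)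
        = (\<integral>\<^sup>+p. ennreal (r (fst p) (snd p)) * indicator (C \<times> B) p \<partial>(D \<Otimes>\<^sub>M lborel))"
      by (rule emeasure_density) auto
    also have "\<dots> = (\<integral>\<^sup>+z. \<integral>\<^sup>+x. ennreal (r z x) * indicator (C \<times> B) (z, x) \<partial>lborel \<partial>D)"
      by (subst lborel.nn_integral_fst[symmetric]) auto
    also have "\<dots> = (\<integral>\<^sup>+z. (\<integral>\<^sup>+x. ennreal (r z x) * indicator B x \<partial>lborel) * indicator C z \<partial>D)"
      by (intro nn_integral_cong) (simp add: indicator_times split: split_indicator)
    also have "\<dots> = emeasure M {\<omega> \<in> space M. X \<omega> \<in> B \<and> Z \<omega> \<in> C}"
      using r that(2,3) by (simp add: cond_density_def D_def R_def)
    finally show ?thesis .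
  qed
  \<comment> \<open>Rectangles form an intersection-stable generator. A constant exhausting sequence
    suffices, since the total mass is a probability and hence finite.\<close>
  have "density (D \<Otimes>\<^sub>M lborel) (\<lambda>p. ennreal (q (fst p) (snd p))) =
      density (D \<Otimes>\<^sub>M lborel) (\<lambda>p. ennreal (q' (fst p) (snd p)))"
  proof (rule measure_eqI_generator_eq[where A="\<lambda>_. space R \<times> UNIV"
        and E="{C \<times> B | C B. C \<in> sets R \<and> B \<in> sets borel}" and \<Omega>="space R \<times> UNIV"])
    show "Int_stable {C \<times> B | C B. C \<in> sets R \<and> B \<in> sets (borel :: 'b measure)}"
      using Int_stable_pair_measure_generator[of R "borel :: 'b measure"] by simp
    show "emeasure (density (D \<Otimes>\<^sub>M lborel) (\<lambda>p. ennreal (q (fst p) (snd p)))) Y =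
        emeasure (density (D \<Otimes>\<^sub>M lborel) (\<lambda>p. ennreal (q' (fst p) (snd p)))) Y"
      if "Y \<in> {C \<times> B | C B. C \<in> sets R \<and> B \<in> sets borel}" for Y
      using that rect[OF q] rect[OF q'] by auto
    show "range (\<lambda>_. space R \<times> UNIV) \<subseteq> {C \<times> B | C B. C \<in> sets R \<and> B \<in> sets (borel :: 'b measure)}"
      by (intro image_subsetI CollectI exI conjI, rule refl) simp_all
    show "emeasure (density (D \<Otimes>\<^sub>M lborel) (\<lambda>p. ennreal (q (fst p) (snd p)))) (space R \<times> UNIV) \<noteq> \<infinity>"
      using rect[OF q sets.top, of UNIV] by simp
  qed (auto simp: sets_pair_measure D_def dest: sets.sets_into_space)
  hence "AE p in D \<Otimes>\<^sub>M lborel. ennreal (q (fst p) (snd p)) = ennreal (q' (fst p) (snd p))"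
    using D.density_unique[OF meas[OF q] meas[OF q']] by blast
  hence "AE z in D. AE x in lborel. ennreal (q z x) = ennreal (q' z x)"
    using D.AE_pair by fastforce
  \<comment> \<open>\<open>ennreal\<close> identifies all negative reals with 0, so nonnegativity is
    required to return to real values. It holds for \<open>z\<close> in \<open>S\<close>, which is
    all of the space of \<open>D\<close>.\<close>
  moreover have "AE z in D. (\<forall>x. 0 \<le> q z x) \<and> (\<forall>x. 0 \<le> q' z x)"
    using q q' by (auto simp: cond_density_def space_D)
  ultimately show ?thesis
    unfolding D_def[symmetric] R_def[symmetric] by eventually_elim auto
qed

text \<open>Supplies the product form of the joint law that \<open>distributed_joint_indep'\<close>
  asks for. Independence of the generated sigma-algebras is the product rule on rectangles, and
  these determine the product of the two laws.\<close>

lemma (in prob_space) distr_pair_indep_set: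
  assumes [measurable]: "X \<in> measurable M S" "Y \<in> measurable M T"
    and indep: "indep_set (sets (vimage_algebra (space M) X S)) (sets (vimage_algebra (space M) Y T))"
  shows "distr M S X \<Otimes>\<^sub>M distr M T Y = distr M (S \<Otimes>\<^sub>M T) (\<lambda>\<omega>. (X \<omega>, Y \<omega>))"
proof -
  interpret X: prob_space "distr M S X" by (rule prob_space_distr) fact
  interpret Y: prob_space "distr M T Y" by (rule prob_space_distr) fact
  show ?thesis
  proof (rule pair_measure_eqI)
    fix B C
    assume "B \<in> sets (distr M S X)" "C \<in> sets (distr M T Y)"
    hence [measurable]: "B \<in> sets S" "C \<in> sets T" by simp_all
    have "(\<lambda>\<omega>. (X \<omega>, Y \<omega>)) -` (B \<times> C) \<inter> space M = (X -` B \<inter> space M) \<inter> (Y -` C \<inter> space M)"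
      by auto
    moreover have "prob ((X -` B \<inter> space M) \<inter> (Y -` C \<inter> space M)) =
        prob (X -` B \<inter> space M) * prob (Y -` C \<inter> space M)"
      by (rule indep_setD[OF indep]) (auto intro: in_vimage_algebra)
    ultimately show "emeasure (distr M S X) B * emeasure (distr M T Y) C =
        emeasure (distr M (S \<Otimes>\<^sub>M T) (\<lambda>\<omega>. (X \<omega>, Y \<omega>))) (B \<times> C)"
      by (simp add: emeasure_distr emeasure_eq_measure ennreal_mult')
  qed (auto intro: X.sigma_finite_measure_axioms Y.sigma_finite_measure_axioms)
qed

text \<open>The mean ignores changes of the density on Lebesgue null sets, so almost everywhere
  uniqueness under the law of \<open>Z\<close> can be pulled back along \<open>Z\<close>.\<close>

lemma AE_density_mean_cond_density:
  assumes "prob_space M"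
    and q: "cond_density M X Z S q" and q': "cond_density M X Z S q'"
  shows "AE \<omega> in M. density_mean (q (Z \<omega>)) = density_mean (q' (Z \<omega>))"
proof -
  have Z: "Z \<in> measurable M (restrict_space borel S)"
    and meas: "(\<lambda>(z, x). q z x) \<in> borel_measurable (restrict_space borel S \<Otimes>\<^sub>M borel)"
      "(\<lambda>(z, x). q' z x) \<in> borel_measurable (restrict_space borel S \<Otimes>\<^sub>M borel)"
    using q q' by (simp_all add: cond_density_def)
  have "AE \<omega> in M. AE x in lborel. q (Z \<omega>) x = q' (Z \<omega>) x"
    using cond_density_unique[OF assms] by (rule AE_distrD[OF Z])
  moreover have "AE \<omega> in M. Z \<omega> \<in> S"
    using measurable_space[OF Z] by (auto simp: space_restrict_space)
  ultimately show ?thesis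
  proof eventually_elim
    case (elim \<omega>)
    have [measurable]: "q (Z \<omega>) \<in> borel_measurable borel" "q' (Z \<omega>) \<in> borel_measurable borel"
      using measurable_Pair2[OF meas(1), of "Z \<omega>"] measurable_Pair2[OF meas(2), of "Z \<omega>"] elim(2)
      by (simp_all add: space_restrict_space)
    show ?case
      unfolding density_mean_def using elim(1) by (intro integral_cong_AE) auto
  qed
qed

section \<open>Data density and posterior density\<close>

locale linear_gaussian_model =
  fixes A :: "real ^ 'n \<Rightarrow> real ^ 'm" and \<delta> :: real and pX :: "real ^ 'n \<Rightarrow> real"
  assumes linear: "linear A"
    and delta_pos: "\<delta> > 0"
    and prior_measurable[measurable]: "pX \<in> borel_measurable borel"
    and prior_pos: "pX u > 0"
    and prior_normalized: "(\<integral>\<^sup>+u. ennreal (pX u) \<partial>lborel) = 1"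
begin

lemma operator_measurable[measurable]: "A \<in> borel_measurable borel"
  and adjoint_measurable[measurable]: "adjoint A \<in> borel_measurable borel"
  using linear adjoint_linear[OF linear]
  by (auto intro!: borel_measurable_continuous_onI linear_continuous_on simp: linear_conv_bounded_linear)

lemma integrable_prior: "integrable lborel pX"
  using prior_pos prior_normalized by (intro integrableI_nonneg) (auto simp: less_imp_le)

lemma integrable_likelihood: "integrable lborel (\<lambda>u. pX u * noise_density \<delta> (A u - y))"
proof (rule Bochner_Integration.integrable_bound)
  show "integrable lborel (\<lambda>u. pX u * (1 / (\<delta> * sqrt (2 * pi)) ^ CARD('m)))"
    using integrable_prior by (rule integrable_mult_left)
  show "AE u in lborel. norm (pX u * noise_density \<delta> (A u - y))
      \<le> norm (pX u * (1 / (\<delta> * sqrt (2 * pi)) ^ CARD('m)))"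
    unfolding real_norm_def abs_mult
    using noise_density_pos[OF delta_pos, of "A _ - y"] noise_density_le[OF delta_pos, of "A _ - y"]
      delta_pos by (intro always_eventually allI mult_left_mono) (auto simp: less_imp_le)
qed measurable

text \<open>A zero integral would make a strictly positive integrand vanish almost everywhere,
  although Lebesgue measure is nonzero. Positivity licenses both the division in the posterior and
  the logarithm in Tweedie's formula.\<close>

lemma data_density_pos: "data_density pX A \<delta> y > 0"
proof -
  have pos: "pX u * noise_density \<delta> (A u - y) > 0" for u
    by (simp add: prior_pos noise_density_pos delta_pos)
  have "data_density pX A \<delta> y \<noteq> 0"
  proof
    assume "data_density pX A \<delta> y = 0"
    hence "AE u in lborel. pX u * noise_density \<delta> (A u - y) = 0"
      using integral_nonneg_eq_0_iff_AE[OF integrable_likelihood] pos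
      by (auto simp: data_density_def less_imp_le)
    hence "AE u in (lborel :: (real ^ 'n) measure). False"
      by eventually_elim (use pos in \<open>auto simp: less_le\<close>)
    thus False
      by (simp add: eventually_False ae_filter_eq_bot_iff)
  qed
  moreover have "data_density pX A \<delta> y \<ge> 0"
    unfolding data_density_def using pos by (intro integral_nonneg_AE) (auto simp: less_imp_le)
  ultimately show ?thesis by simp
qed

lemma posterior_density_nonneg: "posterior_density pX A \<delta> y u \<ge> 0"
  using data_density_pos[of y]
  by (simp add: posterior_density_def less_imp_le prior_pos noise_density_pos delta_pos)

lemma data_density_measurable[measurable]: "data_density pX A \<delta> \<in> borel_measurable borel"
  unfolding data_density_def[abs_def] by measurable

lemma data_density_mult_posterior_density:
  "data_density pX A \<delta> y * posterior_density pX A \<delta> y u = pX u * noise_density \<delta> (A u - y)"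
  using data_density_pos[of y] by (simp add: posterior_density_def)

lemma integrable_posterior_density: "integrable lborel (posterior_density pX A \<delta> y)"
  and integral_posterior_density: "(\<integral>u. posterior_density pX A \<delta> y u \<partial>lborel) = 1"
proof -
  have eq: "posterior_density pX A \<delta> y =
      (\<lambda>u. 1 / data_density pX A \<delta> y * (pX u * noise_density \<delta> (A u - y)))"
    by (simp add: posterior_density_def fun_eq_iff)
  show "integrable lborel (posterior_density pX A \<delta> y)"
    unfolding eq using integrable_likelihood by (rule integrable_mult_right)
  show "(\<integral>u. posterior_density pX A \<delta> y u \<partial>lborel) = 1"
    unfolding eq integral_mult_right_zero data_density_def[symmetric]
    using data_density_pos[of y] by simp
qed

lemma nn_integral_posterior_density: "(\<integral>\<^sup>+u. ennreal (posterior_density pX A \<delta> y u) \<partial>lborel) = 1"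
  by (simp add: nn_integral_eq_integral integrable_posterior_density integral_posterior_density
      posterior_density_nonneg)

text \<open>\<open>gderiv_integral\<close> with the dominating function \<open>pX u * K\<close>,
  where \<open>K\<close> bounds the gradient of the noise density and is also its Lipschitz
  constant. The integrability claim is used later to split an integral.\<close>

lemma GDERIV_data_density:
  "integrable lborel (\<lambda>u. (pX u * noise_density \<delta> (A u - y) / \<delta>\<^sup>2) *\<^sub>R (A u - y))"
  "GDERIV (data_density pX A \<delta>) y :>
    (\<integral>u. (pX u * noise_density \<delta> (A u - y) / \<delta>\<^sup>2) *\<^sub>R (A u - y) \<partial>lborel)"
proof -
  define K where "K = 1 / (\<delta> * sqrt (2 * pi)) ^ CARD('m) / \<delta>"
  \<comment> \<open>The noise density is even. With \<open>v - A u\<close> as argument, the inner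
    derivative in \<open>v\<close> is the identity.\<close>
  have sym: "data_density pX A \<delta> = (\<lambda>v. \<integral>u. pX u * noise_density \<delta> (v - A u) \<partial>lborel)"
    by (simp add: data_density_def fun_eq_iff noise_density_minus_commute[of \<delta> _ "A _"])
  have int: "integrable lborel (\<lambda>u. pX u * noise_density \<delta> (v - A u))" for v
    using integrable_likelihood[of v] by (simp add: noise_density_minus_commute[of \<delta> v])
  have w: "integrable lborel (\<lambda>u. pX u * K)"
    using integrable_prior by (rule integrable_mult_left)
  have deriv: "GDERIV (\<lambda>v. pX u * noise_density \<delta> (v - A u)) y :>
      (pX u * noise_density \<delta> (A u - y) / \<delta>\<^sup>2) *\<^sub>R (A u - y)" for u
  proof -
    have "(noise_density \<delta> has_derivative
        (\<lambda>h. h \<bullet> (- (noise_density \<delta> (y - A u) / \<delta>\<^sup>2) *\<^sub>R (y - A u)))) (at (y - A u))"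
      using GDERIV_noise_density[of \<delta> "y - A u"] delta_pos by (simp add: gderiv_def)
    moreover have "((\<lambda>v. v - A u) has_derivative (\<lambda>h. h)) (at y)"
      by (auto intro!: derivative_eq_intros)
    ultimately have "((\<lambda>v. noise_density \<delta> (v - A u)) has_derivative
        (\<lambda>h. h \<bullet> (- (noise_density \<delta> (y - A u) / \<delta>\<^sup>2) *\<^sub>R (y - A u)))) (at y)"
      using has_derivative_compose by fastforce
    hence "((\<lambda>v. pX u * noise_density \<delta> (v - A u)) has_derivative
        (\<lambda>h. pX u * (h \<bullet> (- (noise_density \<delta> (y - A u) / \<delta>\<^sup>2) *\<^sub>R (y - A u))))) (at y)"
      by (rule has_derivative_mult_right)
    thus ?thesis
      unfolding gderiv_def
      by (simp add: noise_density_minus_commute[of \<delta> y] inner_diff_right algebra_simps diff_divide_distrib)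
  qed
  have lipschitz: "\<bar>pX u * noise_density \<delta> (v - A u) - pX u * noise_density \<delta> (y - A u)\<bar>
      \<le> pX u * K * norm (v - y)" for u v
    using mult_left_mono[OF noise_density_lipschitz[OF delta_pos, of "v - A u" "y - A u"],
        of "pX u"] prior_pos[of u]
    by (simp add: K_def right_diff_distrib[symmetric] abs_mult)
  have bound: "norm ((pX u * noise_density \<delta> (A u - y) / \<delta>\<^sup>2) *\<^sub>R (A u - y)) \<le> pX u * K" for u
    using mult_left_mono[OF norm_gradient_noise_density_le[OF delta_pos, of "A u - y"], of "pX u"]
      prior_pos[of u] by (simp add: K_def abs_mult)
  have meas: "(\<lambda>u. (pX u * noise_density \<delta> (A u - y) / \<delta>\<^sup>2) *\<^sub>R (A u - y)) \<in> borel_measurable lborel"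
    by measurable
  show "integrable lborel (\<lambda>u. (pX u * noise_density \<delta> (A u - y) / \<delta>\<^sup>2) *\<^sub>R (A u - y))"
    by (rule gderiv_integral(1)[OF int meas w deriv lipschitz bound])
  show "GDERIV (data_density pX A \<delta>) y :>
      (\<integral>u. (pX u * noise_density \<delta> (A u - y) / \<delta>\<^sup>2) *\<^sub>R (A u - y) \<partial>lborel)"
    unfolding sym by (rule gderiv_integral(2)[OF int meas w deriv lipschitz bound])
qed

section \<open>Tweedie's formula for the posterior mean\<close>

text \<open>Split \<open>A u = y + (A u - y)\<close> under the posterior. The constant part
  integrates to \<open>y\<close> since the posterior has mass one. The deviation part is
  \<open>\<delta>\<^sup>2 / data_density pX A \<delta> y\<close> times the integrand of the gradient
  of the data density, which gives \<open>\<delta>\<^sup>2\<close> times the logarithmic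
  gradient.\<close>

lemma tweedie_formula:
  assumes "integrable lborel (\<lambda>u. posterior_density pX A \<delta> y u *\<^sub>R u)"
  obtains g where "GDERIV (\<lambda>v. ln (data_density pX A \<delta> v)) y :> g"
    and "A (density_mean (posterior_density pX A \<delta> y)) = y + \<delta>\<^sup>2 *\<^sub>R g"
proof
  let ?D = "\<integral>u. (pX u * noise_density \<delta> (A u - y) / \<delta>\<^sup>2) *\<^sub>R (A u - y) \<partial>lborel"
  let ?g = "inverse (data_density pX A \<delta> y) *\<^sub>R ?D"
  have "(ln has_real_derivative inverse (data_density pX A \<delta> y)) (at (data_density pX A \<delta> y))"
    using data_density_pos[of y] by (rule DERIV_ln)
  thus "GDERIV (\<lambda>v. ln (data_density pX A \<delta> v)) y :> ?g"
    by (rule GDERIV_DERIV_compose[OF GDERIV_data_density(2)])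
  have bl: "bounded_linear A"
    using linear by (simp add: linear_conv_bounded_linear)
  have "A (density_mean (posterior_density pX A \<delta> y)) =
      (\<integral>u. A (posterior_density pX A \<delta> y u *\<^sub>R u) \<partial>lborel)"
    unfolding density_mean_def by (rule integral_bounded_linear[OF bl assms, symmetric])
  also have "\<dots> = (\<integral>u. posterior_density pX A \<delta> y u *\<^sub>R y + (\<delta>\<^sup>2 / data_density pX A \<delta> y) *\<^sub>R
      ((pX u * noise_density \<delta> (A u - y) / \<delta>\<^sup>2) *\<^sub>R (A u - y)) \<partial>lborel)"
  proof (rule Bochner_Integration.integral_cong[OF refl])
    fix u
    have "(\<delta>\<^sup>2 / data_density pX A \<delta> y) *\<^sub>R ((pX u * noise_density \<delta> (A u - y) / \<delta>\<^sup>2) *\<^sub>R (A u - y))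
        = posterior_density pX A \<delta> y u *\<^sub>R (A u - y)"
      using delta_pos by (simp add: posterior_density_def)
    thus "A (posterior_density pX A \<delta> y u *\<^sub>R u) = posterior_density pX A \<delta> y u *\<^sub>R y +
        (\<delta>\<^sup>2 / data_density pX A \<delta> y) *\<^sub>R ((pX u * noise_density \<delta> (A u - y) / \<delta>\<^sup>2) *\<^sub>R (A u - y))"
      by (simp only: linear_cmul[OF linear] scaleR_diff_right add_diff_cancel_left')
        (simp add: algebra_simps)
  qed
  also have "\<dots> = y + (\<delta>\<^sup>2 / data_density pX A \<delta> y) *\<^sub>R ?D"
  proof -
    have "(\<integral>u. posterior_density pX A \<delta> y u *\<^sub>R y + (\<delta>\<^sup>2 / data_density pX A \<delta> y) *\<^sub>R
        ((pX u * noise_density \<delta> (A u - y) / \<delta>\<^sup>2) *\<^sub>R (A u - y)) \<partial>lborel) =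
        (\<integral>u. posterior_density pX A \<delta> y u *\<^sub>R y \<partial>lborel) +
        (\<integral>u. (\<delta>\<^sup>2 / data_density pX A \<delta> y) *\<^sub>R
          ((pX u * noise_density \<delta> (A u - y) / \<delta>\<^sup>2) *\<^sub>R (A u - y)) \<partial>lborel)"
      by (intro Bochner_Integration.integral_add integrable_scaleR_left integrable_scaleR_right
          integrable_posterior_density GDERIV_data_density(1))
    also have "(\<integral>u. posterior_density pX A \<delta> y u *\<^sub>R y \<partial>lborel) = y"
      by (subst integral_scaleR_left)
        (simp_all add: integrable_posterior_density integral_posterior_density)
    finally show ?thesis
      by (simp only: integral_scaleR_right)
  qed
  finally show "A (density_mean (posterior_density pX A \<delta> y)) = y + \<delta>\<^sup>2 *\<^sub>R ?g"
    by (simp add: divide_inverse)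
qed

section \<open>The posterior as a function of the normal-equation data\<close>

text \<open>The unnormalized posterior without its factor depending on \<open>y\<close> alone.
  Writing the cross term as \<open>u \<bullet> z\<close> makes it meaningful for every
  \<open>z\<close>.\<close>

definition posterior_weight :: "real ^ 'n \<Rightarrow> real ^ 'n \<Rightarrow> real" where
  "posterior_weight z u = exp ((2 * (u \<bullet> z) - (norm (A u))\<^sup>2) / (2 * \<delta>\<^sup>2)) * pX u"

text \<open>
  For \<open>z\<close> outside the range of \<open>adjoint A\<close> the normalizing integral may diverge, in which case
  \<open>normal_posterior z\<close> is the zero function (not a density).
\<close>

definition normal_posterior :: "real ^ 'n \<Rightarrow> real ^ 'n \<Rightarrow> real" where
  "normal_posterior z u = posterior_weight z u / (\<integral>u'. posterior_weight z u' \<partial>lborel)"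

lemma normal_posterior_measurable[measurable]:
  "(\<lambda>(z, u). normal_posterior z u) \<in> borel_measurable (borel \<Otimes>\<^sub>M borel)"
  unfolding normal_posterior_def[abs_def] posterior_weight_def[abs_def] case_prod_unfold
  by measurable

lemma posterior_density_eq_normal_posterior:
  "posterior_density pX A \<delta> y u = normal_posterior (adjoint A y) u"
proof -
  \<comment> \<open>\<open>c\<close> is \<open>noise_density \<delta> y\<close>, the factor free of
    \<open>u\<close>; it cancels against the normalizing integral.\<close>
  define c where "c = 1 / (\<delta> * sqrt (2 * pi)) ^ CARD('m) * exp (- (norm y)\<^sup>2 / (2 * \<delta>\<^sup>2))"
  have "c > 0"
    using delta_pos by (simp add: c_def)
  have "- (norm (A u - y))\<^sup>2 / (2 * \<delta>\<^sup>2) =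
      - (norm y)\<^sup>2 / (2 * \<delta>\<^sup>2) + (2 * (u \<bullet> adjoint A y) - (norm (A u))\<^sup>2) / (2 * \<delta>\<^sup>2)" for u
    by (simp add: adjoint_works[OF linear] power2_norm_eq_inner inner_diff inner_commute
        diff_divide_distrib add_divide_distrib)
  hence weight: "pX u * noise_density \<delta> (A u - y) = c * posterior_weight (adjoint A y) u" for u
    by (simp only: noise_density_def posterior_weight_def c_def exp_add mult_ac)
  have "posterior_density pX A \<delta> y u = (c * posterior_weight (adjoint A y) u) /
      (\<integral>u'. c * posterior_weight (adjoint A y) u' \<partial>lborel)"
    unfolding weight[symmetric] by (simp add: posterior_density_def data_density_def)
  thus ?thesis
    using \<open>c > 0\<close> by (simp add: normal_posterior_def)
qed

text \<open>Conditioning on the full data \<open>A (x \<omega>) + \<eta> \<omega>\<close> gives a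
  posterior mass of \<open>B\<close> that depends on the data only through \<open>adjoint A\<close>.
  It is thus a function \<open>h\<close> of \<open>?z\<close>, and its expectation is an integral
  against the law of \<open>?z\<close>, which may be singular.\<close>

lemma cond_density_normal_posterior:
  assumes "prob_space M"
    and x: "distributed M lborel x (\<lambda>u. ennreal (pX u))"
    and \<eta>: "distributed M lborel \<eta> (\<lambda>v. ennreal (noise_density \<delta> v))"
    and indep: "prob_space.indep_set M (sets (vimage_algebra (space M) x borel))
      (sets (vimage_algebra (space M) \<eta> borel))"
  shows "cond_density M x (\<lambda>\<omega>. adjoint A (A (x \<omega>) + \<eta> \<omega>)) (range (adjoint A)) normal_posterior"
proof -
  interpret prob_space M by fact
  let ?R = "restrict_space borel (range (adjoint A))"
  let ?z = "\<lambda>\<omega>. adjoint A (A (x \<omega>) + \<eta> \<omega>)"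
  have [measurable]: "x \<in> borel_measurable M" "\<eta> \<in> borel_measurable M"
    using distributed_measurable[OF x] distributed_measurable[OF \<eta>] by simp_all
  have z[measurable]: "?z \<in> measurable M ?R"
    by (rule measurable_restrict_space2) auto
  have "distr M lborel x \<Otimes>\<^sub>M distr M lborel \<eta> =
      distr M (lborel \<Otimes>\<^sub>M lborel) (\<lambda>\<omega>. (x \<omega>, \<eta> \<omega>))"
    using indep by (intro distr_pair_indep_set) (simp_all add: sets_vimage_algebra)
  hence joint: "distributed M (lborel \<Otimes>\<^sub>M lborel) (\<lambda>\<omega>. (x \<omega>, \<eta> \<omega>))
      (\<lambda>(u, v). ennreal (pX u) * ennreal (noise_density \<delta> v))"
    by (intro distributed_joint_indep' x \<eta> lborel.sigma_finite_measure_axioms)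
  \<comment> \<open>Bayes' rule in integrated form: average over the posterior for fixed data, then
    over the data density.\<close>
  have law: "(\<integral>\<^sup>+\<omega>. f (x \<omega>) (A (x \<omega>) + \<eta> \<omega>) \<partial>M) =
      (\<integral>\<^sup>+y. ennreal (data_density pX A \<delta> y) *
        (\<integral>\<^sup>+u. ennreal (posterior_density pX A \<delta> y u) * f u y \<partial>lborel) \<partial>lborel)"
    if [measurable]: "(\<lambda>(u, y). f u y) \<in> borel_measurable (borel \<Otimes>\<^sub>M borel)" for f
  proof -
    have "(\<integral>\<^sup>+\<omega>. f (x \<omega>) (A (x \<omega>) + \<eta> \<omega>) \<partial>M) =
        (\<integral>\<^sup>+(u, v). ennreal (pX u) * ennreal (noise_density \<delta> v) * f u (A u + v)
          \<partial>(lborel \<Otimes>\<^sub>M lborel))"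
      using distributed_nn_integral[OF joint, of "\<lambda>(u, v). f u (A u + v)"]
      by (simp add: case_prod_unfold)
    also have "\<dots> = (\<integral>\<^sup>+u. \<integral>\<^sup>+v. ennreal (pX u) * ennreal (noise_density \<delta> v) * f u (A u + v)
        \<partial>lborel \<partial>lborel)"
      by (subst lborel.nn_integral_fst[symmetric]) auto
    also have "\<dots> = (\<integral>\<^sup>+u. \<integral>\<^sup>+y. ennreal (pX u) * ennreal (noise_density \<delta> (A u - y)) * f u y
        \<partial>lborel \<partial>lborel)"
    \<comment> \<open>For fixed \<open>u\<close> substitute \<open>y = A u + v\<close>: Lebesgue
      measure is translation invariant and the noise density is even.\<close>
    proof (rule nn_integral_cong)
      fix u
      have "(\<integral>\<^sup>+y. ennreal (pX u) * ennreal (noise_density \<delta> (A u - y)) * f u y \<partial>lborel) =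
          (\<integral>\<^sup>+y. ennreal (pX u) * ennreal (noise_density \<delta> (A u - y)) * f u y
            \<partial>distr lborel borel ((+) (A u)))"
        by (simp add: lborel_distr_plus)
      also have "\<dots> = (\<integral>\<^sup>+v. ennreal (pX u) * ennreal (noise_density \<delta> v) * f u (A u + v) \<partial>lborel)"
        by (subst nn_integral_distr) (simp_all add: noise_density_def)
      finally show "(\<integral>\<^sup>+v. ennreal (pX u) * ennreal (noise_density \<delta> v) * f u (A u + v) \<partial>lborel) =
          (\<integral>\<^sup>+y. ennreal (pX u) * ennreal (noise_density \<delta> (A u - y)) * f u y \<partial>lborel)" ..
    qed
    also have "\<dots> = (\<integral>\<^sup>+y. \<integral>\<^sup>+u. ennreal (pX u) * ennreal (noise_density \<delta> (A u - y)) * f u y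
        \<partial>lborel \<partial>lborel)"
      by (rule lborel_pair.Fubini'[symmetric]) measurable
    also have "\<dots> = (\<integral>\<^sup>+y. \<integral>\<^sup>+u. ennreal (data_density pX A \<delta> y) *
        (ennreal (posterior_density pX A \<delta> y u) * f u y) \<partial>lborel \<partial>lborel)"
    proof (intro nn_integral_cong)
      fix u y
      have "ennreal (pX u) * ennreal (noise_density \<delta> (A u - y)) =
          ennreal (data_density pX A \<delta> y) * ennreal (posterior_density pX A \<delta> y u)"
        using prior_pos[of u] data_density_pos[of y] data_density_mult_posterior_density[of y u]
        by (simp add: ennreal_mult'[symmetric] less_imp_le)
      thus "ennreal (pX u) * ennreal (noise_density \<delta> (A u - y)) * f u y =
          ennreal (data_density pX A \<delta> y) * (ennreal (posterior_density pX A \<delta> y u) * f u y)"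
        by (simp add: mult.assoc)
    qed
    also have "\<dots> = (\<integral>\<^sup>+y. ennreal (data_density pX A \<delta> y) *
        (\<integral>\<^sup>+u. ennreal (posterior_density pX A \<delta> y u) * f u y \<partial>lborel) \<partial>lborel)"
      by (intro nn_integral_cong nn_integral_cmult) (simp add: posterior_density_eq_normal_posterior)
    finally show ?thesis .
  qed
  have "emeasure M {\<omega> \<in> space M. x \<omega> \<in> B \<and> ?z \<omega> \<in> C} =
      (\<integral>\<^sup>+z\<in>C. (\<integral>\<^sup>+u\<in>B. ennreal (normal_posterior z u) \<partial>lborel) \<partial>distr M ?R ?z)"
    if [measurable]: "B \<in> sets borel" and C_sets: "C \<in> sets ?R" for B C
  proof -
    obtain C' where [measurable]: "C' \<in> sets borel" and C: "C = C' \<inter> range (adjoint A)"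
      using C_sets by (auto simp: sets_restrict_space)
    \<comment> \<open>Using the Borel set \<open>C'\<close> in place of its trace \<open>C\<close>
      makes \<open>h\<close> Borel on the whole space. Nothing changes, because \<open>?z\<close>
      takes its values in the range of \<open>adjoint A\<close>.\<close>
    define h where "h z = (\<integral>\<^sup>+u. ennreal (normal_posterior z u) * indicator B u \<partial>lborel) * indicator C' z" for z
    have [measurable]: "h \<in> borel_measurable borel"
      unfolding h_def[abs_def] by measurable
    have h: "h z = (\<integral>\<^sup>+u. ennreal (normal_posterior z u) * (indicator B u * indicator C' z) \<partial>lborel)" for z
      unfolding h_def by (subst nn_integral_multc[symmetric]) (simp_all add: mult.assoc)
    have "emeasure M {\<omega> \<in> space M. x \<omega> \<in> B \<and> ?z \<omega> \<in> C} =
        (\<integral>\<^sup>+\<omega>. indicator {\<omega> \<in> space M. x \<omega> \<in> B \<and> ?z \<omega> \<in> C'} \<omega> \<partial>M)"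
      by (simp add: C)
    also have "\<dots> = (\<integral>\<^sup>+\<omega>. indicator B (x \<omega>) * indicator C' (adjoint A (A (x \<omega>) + \<eta> \<omega>)) \<partial>M)"
      by (intro nn_integral_cong) (auto split: split_indicator)
    also have "\<dots> = (\<integral>\<^sup>+y. ennreal (data_density pX A \<delta> y) * h (adjoint A y) \<partial>lborel)"
      by (subst law[of "\<lambda>u y. indicator B u * indicator C' (adjoint A y)"])
        (simp_all add: h posterior_density_eq_normal_posterior)
    \<comment> \<open>Second use of \<open>law\<close>, now backwards: the test function does not
      depend on \<open>u\<close>, so the inner integral only contributes the posterior mass
      one.\<close>
    also have "\<dots> = (\<integral>\<^sup>+\<omega>. h (?z \<omega>) \<partial>M)"
    proof -
      have "(\<integral>\<^sup>+u. ennreal (posterior_density pX A \<delta> y u) * c \<partial>lborel) = c" for y c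
        by (subst nn_integral_multc)
          (use integrable_posterior_density in \<open>auto simp: nn_integral_posterior_density\<close>)
      thus ?thesis
        by (subst law[of "\<lambda>u y. h (adjoint A y)"]) simp_all
    qed
    also have "\<dots> = (\<integral>\<^sup>+z. h z \<partial>distr M ?R ?z)"
      by (subst nn_integral_distr) (auto intro: measurable_restrict_space1)
    also have "\<dots> = (\<integral>\<^sup>+z\<in>C. (\<integral>\<^sup>+u\<in>B. ennreal (normal_posterior z u) \<partial>lborel) \<partial>distr M ?R ?z)"
      by (intro nn_integral_cong)
        (auto simp: h_def space_restrict_space C split: split_indicator)
    finally show ?thesis .
  qed
  moreover have "(\<lambda>(z, u). normal_posterior z u) \<in> borel_measurable (?R \<Otimes>\<^sub>M borel)"
  proof -
    have "(\<lambda>p. (fst p, snd p)) \<in> measurable (?R \<Otimes>\<^sub>M borel) (borel \<Otimes>\<^sub>M borel)"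
      by (intro measurable_Pair measurable_compose[OF measurable_fst measurable_restrict_space1])
        auto
    from measurable_compose[OF this normal_posterior_measurable] show ?thesis
      by (simp add: case_prod_unfold)
  qed
  moreover have "0 \<le> normal_posterior z u" "(\<integral>\<^sup>+u. ennreal (normal_posterior z u) \<partial>lborel) = 1"
    if "z \<in> range (adjoint A)" for z u
    using that posterior_density_nonneg nn_integral_posterior_density
    by (auto simp: posterior_density_eq_normal_posterior)
  ultimately show ?thesis
    using z by (auto simp: cond_density_def)
qed

end

section \<open>Comparison of the two inverse problems\<close>

theorem lemma1:
  fixes A :: "real ^ 'n \<Rightarrow> real ^ 'm"
    and \<delta> :: real
    and pX :: "real ^ 'n \<Rightarrow> real"
    and M :: "'s measure"
    and x :: "'s \<Rightarrow> real ^ 'n"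
    and \<eta> yd :: "'s \<Rightarrow> real ^ 'm"
    and zd :: "'s \<Rightarrow> real ^ 'n"
  assumes "linear A"
    and "\<delta> > 0"
    and "continuously_differentiable pX"
    and "\<And>u. pX u > 0"
    and "(\<integral>\<^sup>+u. ennreal (pX u) \<partial>lborel) = 1"
    and "\<And>y. integrable lborel (\<lambda>u. posterior_density pX A \<delta> y u *\<^sub>R u)"
    and "prob_space M"
    and "distributed M lborel x (\<lambda>u. ennreal (pX u))"
    and "distributed M lborel \<eta> (\<lambda>v. ennreal (noise_density \<delta> v))"
    and "prob_space.indep_set M (sets (vimage_algebra (space M) x borel))
           (sets (vimage_algebra (space M) \<eta> borel))"
    and "yd = (\<lambda>\<omega>. A (x \<omega>) + \<eta> \<omega>)"
    and "zd = (\<lambda>\<omega>. adjoint A (yd \<omega>))"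
  shows "(\<exists>q :: real ^ 'n \<Rightarrow> real ^ 'n \<Rightarrow> real.
            cond_density M x zd (range (adjoint A)) q \<and>
            (\<forall>y u. posterior_density pX A \<delta> y u = q (adjoint A y) u) \<and>
            cond_density M x (\<lambda>\<omega>. adjoint A (A (x \<omega>)) + adjoint A (\<eta> \<omega>)) (range (adjoint A)) q \<and>
            (\<forall>y. density_mean (posterior_density pX A \<delta> y) = density_mean (q (adjoint A y))))
       \<and> (\<forall>q' :: real ^ 'n \<Rightarrow> real ^ 'n \<Rightarrow> real.
            cond_density M x (\<lambda>\<omega>. adjoint A (A (x \<omega>)) + adjoint A (\<eta> \<omega>)) (range (adjoint A)) q' \<longrightarrow>
            (AE \<omega> in M. density_mean (posterior_density pX A \<delta> (yd \<omega>)) = density_mean (q' (zd \<omega>))))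
       \<and> (\<forall>y. \<exists>g. (GDERIV (\<lambda>v. ln (data_density pX A \<delta> v)) y :> g) \<and>
            A (density_mean (posterior_density pX A \<delta> y)) = y + \<delta>\<^sup>2 *\<^sub>R g)"
proof -
  interpret linear_gaussian_model A \<delta> pX
  proof (rule linear_gaussian_model.intro)
    have "continuous_on UNIV pX"
      using assms(3) by (auto simp: continuously_differentiable_def gderiv_def
          intro: has_derivative_continuous continuous_at_imp_continuous_on)
    thus "pX \<in> borel_measurable borel"
      by (rule borel_measurable_continuous_onI)
  qed (fact assms)+
  \<comment> \<open>By linearity of the adjoint, the data of the normal-equation problem are
    \<open>zd\<close> itself, so one conditional density serves both formulations.\<close>
  have zd: "zd = (\<lambda>\<omega>. adjoint A (A (x \<omega>) + \<eta> \<omega>))"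
    and zd': "(\<lambda>\<omega>. adjoint A (A (x \<omega>)) + adjoint A (\<eta> \<omega>)) = zd"
    using linear_add[OF adjoint_linear[OF \<open>linear A\<close>]] by (simp_all add: assms(11,12))
  have cond: "cond_density M x zd (range (adjoint A)) normal_posterior"
    unfolding zd using assms(7-10) by (rule cond_density_normal_posterior)
  have mean: "density_mean (posterior_density pX A \<delta> y) = density_mean (normal_posterior (adjoint A y))" for y
    by (simp add: density_mean_def posterior_density_eq_normal_posterior)
  show ?thesis
    unfolding zd'
  proof (intro conjI allI impI exI[of _ normal_posterior])
    fix q'
    assume "cond_density M x zd (range (adjoint A)) q'"
    \<comment> \<open>An arbitrary version is determined only up to null sets of the law of
      \<open>zd\<close>, so its mean is compared almost surely. The particular version
      \<open>normal_posterior\<close> gives equality for every \<open>y\<close>.\<close>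
    from AE_density_mean_cond_density[OF \<open>prob_space M\<close> cond this]
    show "AE \<omega> in M. density_mean (posterior_density pX A \<delta> (yd \<omega>)) = density_mean (q' (zd \<omega>))"
      by (simp add: mean assms(12))
  next
    fix y
    show "\<exists>g. GDERIV (\<lambda>v. ln (data_density pX A \<delta> v)) y :> g \<and>
        A (density_mean (posterior_density pX A \<delta> y)) = y + \<delta>\<^sup>2 *\<^sub>R g"
      using tweedie_formula[OF assms(6)] by metis
  qed (simp_all add: cond mean posterior_density_eq_normal_posterior)
qed

end
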